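(* Let $X$ be a Priestley space. Then $(\mathsf{CC}(X),\unlhd)$, with the topology generated by the sets $\Box V$ and $\Diamond V$ for $V$ clopen in $X$, is an Esakia root system.
   Context: A Priestley space is a compact space with a partial order such that $x\not\le y$ implies a clopen upset containing $x$ but not $y$. $\mathsf{CC}(X)$ is the set of nonempty closed chains (totally ordered closed subsets) of $X$; $\Box V=\{C\in\mathsf{CC}(X)\mid C\subseteq V\}$, $\Diamond V=\{C\in\mathsf{CC}(X)\mid C\cap V\ne\varnothing\}$; $C_1\unlhd C_2$ iff $C_2\subseteq C_1$ and $C_2$ is an upset of $C_1$. An Esakia space is a Priestley space in which ${\downarrow}V$ is clopen for every clopen $V$; an Esakia root system is an Esakia space in which ${\uparrow}y$ is a chain for every point $y$. *)

theory Defs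
  imports "HOL-Analysis.Analysis"
begin

text \<open>An ordered space is a topology \<open>X\<close> together with a relation \<open>r\<close> on \<open>topspace X\<close>,
  where \<open>(x, y) \<in> r\<close> means \<open>x \<le> y\<close>.\<close>

definition clopenin :: "'a topology \<Rightarrow> 'a set \<Rightarrow> bool" where
  "clopenin X V \<longleftrightarrow> openin X V \<and> closedin X V"

definition upset_of :: "'a rel \<Rightarrow> 'a set \<Rightarrow> 'a set \<Rightarrow> bool" where
  "upset_of r A U \<longleftrightarrow> U \<subseteq> A \<and> (\<forall>x\<in>U. \<forall>y\<in>A. (x, y) \<in> r \<longrightarrow> y \<in> U)"

definition upclosure :: "'a rel \<Rightarrow> 'a set \<Rightarrow> 'a set" where
  "upclosure r V = r `` V"

definition downclosure :: "'a rel \<Rightarrow> 'a set \<Rightarrow> 'a set" where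
  "downclosure r V = r\<inverse> `` V"

definition priestley_space :: "'a topology \<Rightarrow> 'a rel \<Rightarrow> bool" where
  "priestley_space X r \<longleftrightarrow>
     compact_space X \<and> partial_order_on (topspace X) r \<and>
     (\<forall>x\<in>topspace X. \<forall>y\<in>topspace X. (x, y) \<notin> r \<longrightarrow>
        (\<exists>U. clopenin X U \<and> upset_of r (topspace X) U \<and> x \<in> U \<and> y \<notin> U))"

definition esakia_space :: "'a topology \<Rightarrow> 'a rel \<Rightarrow> bool" where
  "esakia_space X r \<longleftrightarrow>
     priestley_space X r \<and> (\<forall>V. clopenin X V \<longrightarrow> clopenin X (downclosure r V))"

definition esakia_root_system :: "'a topology \<Rightarrow> 'a rel \<Rightarrow> bool" where
  "esakia_root_system X r \<longleftrightarrow>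
     esakia_space X r \<and> (\<forall>y\<in>topspace X. upclosure r {y} \<in> Chains r)"

definition CC :: "'a topology \<Rightarrow> 'a rel \<Rightarrow> 'a set set" where
  "CC X r = {C. C \<noteq> {} \<and> closedin X C \<and> C \<in> Chains r}"

definition CC_box :: "'a topology \<Rightarrow> 'a rel \<Rightarrow> 'a set \<Rightarrow> 'a set set" where
  "CC_box X r V = {C \<in> CC X r. C \<subseteq> V}"

definition CC_diamond :: "'a topology \<Rightarrow> 'a rel \<Rightarrow> 'a set \<Rightarrow> 'a set set" where
  "CC_diamond X r V = {C \<in> CC X r. C \<inter> V \<noteq> {}}"

definition CC_topology :: "'a topology \<Rightarrow> 'a rel \<Rightarrow> 'a set topology" where
  "CC_topology X r =
     topology_generated_by ({CC_box X r V |V. clopenin X V} \<union> {CC_diamond X r V |V. clopenin X V})"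

definition CC_order :: "'a topology \<Rightarrow> 'a rel \<Rightarrow> 'a set rel" where
  "CC_order X r =
     {(C1, C2). C1 \<in> CC X r \<and> C2 \<in> CC X r \<and> C2 \<subseteq> C1 \<and> upset_of r C1 C2}"

text \<open>The carrier of \<open>topology_generated_by\<close> is the union of the generating family; here that
  union is all of \<open>CC X r\<close>, since \<open>topspace X\<close> is clopen.\<close>

lemma topspace_CC_topology: "topspace (CC_topology X r) = CC X r"
proof
  show "topspace (CC_topology X r) \<subseteq> CC X r"
    unfolding CC_topology_def CC_box_def CC_diamond_def topology_generated_by_topspace by blast
  have "CC_box X r (topspace X) = CC X r"
    unfolding CC_box_def CC_def using closedin_subset by blast
  moreover have "clopenin X (topspace X)"
    by (simp add: clopenin_def)
  ultimately show "CC X r \<subseteq> topspace (CC_topology X r)"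
    unfolding CC_topology_def topology_generated_by_topspace by blast
qed

end

theory Submission
  imports Defs
begin

text \<open>The space of all nonempty closed sets with the Vietoris topology is compact by Alexander's
  subbase lemma, and \<open>CC X r\<close> is closed in it: if \<open>C\<close> is not a chain, two clopen upsets \<open>U\<close>, \<open>V\<close>
  separate an incomparable pair of its points, so \<open>C\<close> meets both \<open>U - V\<close> and \<open>V - U\<close>, and no
  closed set meeting both is a chain.
  The clopen upsets separating points of \<open>CC X r\<close> have the form \<open>\<box>V\<close> or \<open>\<box>U \<union> \<diamond>(U \<inter> V)\<close> with
  \<open>U\<close> a clopen upset. If \<open>C1 \<unlhd> C2\<close> and \<open>C2 \<subseteq> V\<close>, some clopen upset \<open>U\<close> contains \<open>C2\<close> and
  misses \<open>C1 - V\<close>; then \<open>C \<unlhd> C \<inter> U\<close> for all \<open>C\<close> near \<open>C1\<close>, which makes downsets of open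
  sets open. Downsets of closed sets are closed in every Priestley space.\<close>

section \<open>Clopen sets and separation of compact sets\<close>

lemma clopenin_topspace: "clopenin X (topspace X)"
  by (simp add: clopenin_def)

lemma clopenin_empty: "clopenin X {}"
  by (simp add: clopenin_def)

lemma clopenin_Un: "clopenin X U \<Longrightarrow> clopenin X V \<Longrightarrow> clopenin X (U \<union> V)"
  by (auto simp: clopenin_def)

lemma clopenin_Int: "clopenin X U \<Longrightarrow> clopenin X V \<Longrightarrow> clopenin X (U \<inter> V)"
  by (auto simp: clopenin_def)

lemma clopenin_Diff: "clopenin X U \<Longrightarrow> clopenin X V \<Longrightarrow> clopenin X (U - V)"
  by (auto simp: clopenin_def)

lemma clopenin_subset: "clopenin X U \<Longrightarrow> U \<subseteq> topspace X"
  by (simp add: clopenin_def openin_subset)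

text \<open>Finitely many \<open>P\<close>-sets avoiding \<open>b\<close> already cover
  \<open>A\<close>, and their union is again a \<open>P\<close>-set avoiding
  \<open>b\<close>.\<close>

lemma separate_compact_point:
  assumes "compactin X A"
    and op: "\<And>U. P U \<Longrightarrow> openin X U"
    and empty: "P {}"
    and Un: "\<And>U V. P U \<Longrightarrow> P V \<Longrightarrow> P (U \<union> V)"
    and sep: "\<And>a. a \<in> A \<Longrightarrow> \<exists>U. P U \<and> a \<in> U \<and> b \<notin> U"
  obtains U where "P U" "A \<subseteq> U" "b \<notin> U"
proof -
  let ?\<U> = "{U. P U \<and> b \<notin> U}"
  have "\<forall>U\<in>?\<U>. openin X U" "A \<subseteq> \<Union>?\<U>"
    using op sep by blast+
  then obtain \<F> where \<F>: "finite \<F>" "\<F> \<subseteq> ?\<U>" "A \<subseteq> \<Union>\<F>"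
    using compactinD[OF assms(1)] by meson
  from \<F>(1,2) have "P (\<Union>\<F>)"
    by (induction \<F> rule: finite_induct) (auto simp: empty Un)
  moreover have "b \<notin> \<Union>\<F>"
    using \<F>(2) by blast
  ultimately show ?thesis
    using that \<F>(3) by blast
qed

text \<open>A second compactness argument, now on \<open>B\<close>: the complements of the
  \<open>P\<close>-sets containing \<open>A\<close> cover \<open>B\<close>, and the
  \<open>P\<close>-sets of a finite subcover are intersected. \<open>P\<close> stays abstract so
  that it can be both clopen sets and clopen upsets; the latter are not closed under complement,
  hence the closure conditions mention only unions and intersections.\<close>

lemma separate_compact_compact:
  assumes A: "compactin X A" and B: "compactin X B"
    and clopen: "\<And>U. P U \<Longrightarrow> clopenin X U"
    and empty: "P {}" and top: "P (topspace X)"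
    and Un: "\<And>U V. P U \<Longrightarrow> P V \<Longrightarrow> P (U \<union> V)"
    and Int: "\<And>U V. P U \<Longrightarrow> P V \<Longrightarrow> P (U \<inter> V)"
    and sep: "\<And>a b. a \<in> A \<Longrightarrow> b \<in> B \<Longrightarrow> \<exists>U. P U \<and> a \<in> U \<and> b \<notin> U"
  obtains U where "P U" "A \<subseteq> U" "U \<inter> B = {}"
proof -
  have sepA: "\<exists>U. P U \<and> A \<subseteq> U \<and> b \<notin> U" if "b \<in> B" for b
    using separate_compact_point[where P=P, OF A _ empty Un sep[OF _ that]] clopen
    by (metis clopenin_def)
  let ?\<U> = "{topspace X - U |U. P U \<and> A \<subseteq> U}"
  have "\<forall>V\<in>?\<U>. openin X V"
    using clopen by (auto simp: clopenin_def)
  moreover have "B \<subseteq> \<Union>?\<U>"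
  proof
    fix b
    assume "b \<in> B"
    moreover from this obtain U where "P U" "A \<subseteq> U" "b \<notin> U"
      using sepA by blast
    ultimately show "b \<in> \<Union>?\<U>"
      using compactin_subset_topspace[OF B] by (intro UnionI[of "topspace X - U"]) auto
  qed
  ultimately obtain \<F> where \<F>: "finite \<F>" "\<F> \<subseteq> ?\<U>" "B \<subseteq> \<Union>\<F>"
    using compactinD[OF B] by meson
  from \<F>(1,2) have "\<exists>U. P U \<and> A \<subseteq> U \<and> U \<inter> \<Union>\<F> = {}"
  proof (induction \<F> rule: finite_induct)
    case empty
    then show ?case
      using top compactin_subset_topspace[OF A] by (intro exI[of _ "topspace X"]) simp
  next
    case (insert V \<F>)
    have "V \<in> ?\<U>" "\<F> \<subseteq> ?\<U>"
      using insert.prems by (simp_all only: insert_subset)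
    then obtain W where W: "P W" "A \<subseteq> W" "V = topspace X - W"
      by blast
    obtain U where U: "P U" "A \<subseteq> U" "U \<inter> \<Union>\<F> = {}"
      using insert.IH[OF \<open>\<F> \<subseteq> ?\<U>\<close>] by metis
    have "A \<subseteq> U \<inter> W" "(U \<inter> W) \<inter> \<Union>(insert V \<F>) = {}"
      using U(2,3) W(2,3) by auto
    with Int[OF U(1) W(1)] show ?case
      by metis
  qed
  then obtain U where U: "P U" "A \<subseteq> U" "U \<inter> \<Union>\<F> = {}"
    by metis
  with \<F>(3) have "U \<inter> B = {}"
    by blast
  with U(1,2) show ?thesis
    by (rule that)
qed

section \<open>Separation and closed downsets in Priestley spaces\<close>

context
  fixes X :: "'a topology" and r :: "'a rel"
  assumes priestley: "priestley_space X r"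
begin

lemma priestley_compact: "compact_space X"
  and priestley_order: "partial_order_on (topspace X) r"
  using priestley by (auto simp: priestley_space_def)

lemma priestley_clopen_upset:
  assumes "x \<in> topspace X" "y \<in> topspace X" "(x, y) \<notin> r"
  obtains U where "clopenin X U" "upset_of r (topspace X) U" "x \<in> U" "y \<notin> U"
  using priestley assms unfolding priestley_space_def by blast

lemma priestley_separate_upset:
  assumes "compactin X A" "compactin X B"
    and "\<And>a b. a \<in> A \<Longrightarrow> b \<in> B \<Longrightarrow> (a, b) \<notin> r"
  obtains U where "clopenin X U" "upset_of r (topspace X) U" "A \<subseteq> U" "U \<inter> B = {}"
proof (rule separate_compact_compact[where P = "\<lambda>U. clopenin X U \<and> upset_of r (topspace X) U",
      OF assms(1,2)])
  show "\<exists>U. (clopenin X U \<and> upset_of r (topspace X) U) \<and> a \<in> U \<and> b \<notin> U"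
    if "a \<in> A" "b \<in> B" for a b
    using that assms priestley_clopen_upset[of a b]
    by (metis compactin_subset_topspace subsetD)
qed (use that in \<open>auto simp: clopenin_topspace clopenin_empty clopenin_Un clopenin_Int upset_of_def\<close>)

text \<open>By antisymmetry, for distinct points the order fails in at least one direction, so a
  clopen upset or the complement of one separates them; compactness passes from points to
  sets.\<close>

lemma priestley_separate_clopen:
  assumes "compactin X A" "compactin X B" "A \<inter> B = {}"
  obtains U where "clopenin X U" "A \<subseteq> U" "U \<inter> B = {}"
proof (rule separate_compact_compact[where P = "clopenin X", OF assms(1,2)])
  show "\<exists>U. clopenin X U \<and> a \<in> U \<and> b \<notin> U" if "a \<in> A" "b \<in> B" for a b
  proof -
    have top: "a \<in> topspace X" "b \<in> topspace X" and "a \<noteq> b"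
      using that assms compactin_subset_topspace by blast+
    then consider "(a, b) \<notin> r" | "(b, a) \<notin> r"
      using partial_order_onD(3)[OF priestley_order] by (auto dest: antisymD)
    then show ?thesis
    proof cases
      case 1
      then show ?thesis
        using priestley_clopen_upset[OF top] by metis
    next
      case 2
      then obtain U where "clopenin X U" "b \<in> U" "a \<notin> U"
        using priestley_clopen_upset[OF top(2,1)] by metis
      then show ?thesis
        using top by (intro exI[of _ "topspace X - U"]) (auto simp: clopenin_Diff clopenin_topspace)
    qed
  qed
qed (use that in \<open>auto simp: clopenin_topspace clopenin_empty clopenin_Un clopenin_Int\<close>)

text \<open>A point \<open>z\<close> below no point of \<open>K\<close> has a clopen upset around it
  that misses the compact set \<open>K\<close>. Being an upset, it contains no point below
  \<open>K\<close> either, so the complement of the downset is open.\<close>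

lemma priestley_closedin_downclosure:
  assumes "closedin X K"
  shows "closedin X (downclosure r K)"
proof -
  have sub: "r \<subseteq> topspace X \<times> topspace X"
    using partial_order_onD(4)[OF priestley_order] .
  have K: "compactin X K"
    using assms closedin_compact_space priestley_compact by blast
  have "\<exists>T. openin X T \<and> z \<in> T \<and> T \<subseteq> topspace X - downclosure r K"
    if z: "z \<in> topspace X - downclosure r K" for z
  proof -
    have "compactin X {z}"
      using z by simp
    moreover have "\<And>a b. a \<in> {z} \<Longrightarrow> b \<in> K \<Longrightarrow> (a, b) \<notin> r"
      using z by (auto simp: downclosure_def)
    ultimately obtain U where U: "clopenin X U" "upset_of r (topspace X) U" "{z} \<subseteq> U" "U \<inter> K = {}"
      using priestley_separate_upset K by blast
    have "U \<inter> downclosure r K = {}"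
      using U(2,4) closedin_subset[OF assms] unfolding downclosure_def upset_of_def by blast
    then show ?thesis
      using U clopenin_subset[OF U(1)] by (intro exI[of _ U]) (auto simp: clopenin_def)
  qed
  then have "openin X (topspace X - downclosure r K)"
    using openin_subopen by blast
  moreover have "downclosure r K \<subseteq> topspace X"
    using sub by (auto simp: downclosure_def)
  ultimately show ?thesis
    by (simp add: closedin_def)
qed

end

section \<open>Box and diamond sets and a base of the topology\<close>

lemma openin_CC_box: "clopenin X V \<Longrightarrow> openin (CC_topology X r) (CC_box X r V)"
  unfolding CC_topology_def by (rule topology_generated_by_Basis) blast

lemma openin_CC_diamond: "clopenin X V \<Longrightarrow> openin (CC_topology X r) (CC_diamond X r V)"
  unfolding CC_topology_def by (rule topology_generated_by_Basis) blast

lemma CC_subset_topspace: "C \<in> CC X r \<Longrightarrow> C \<subseteq> topspace X"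
  by (simp add: CC_def closedin_subset)

lemma CC_diamond_eq: "CC_diamond X r V = CC X r - CC_box X r (topspace X - V)"
proof -
  have "C \<inter> V \<noteq> {} \<longleftrightarrow> \<not> C \<subseteq> topspace X - V" if "C \<in> CC X r" for C
    using CC_subset_topspace[OF that] by blast
  then show ?thesis
    by (auto simp: CC_diamond_def CC_box_def)
qed

lemma CC_box_eq: "CC_box X r V = CC X r - CC_diamond X r (topspace X - V)"
proof -
  have "C \<subseteq> V \<longleftrightarrow> C \<inter> (topspace X - V) = {}" if "C \<in> CC X r" for C
    using CC_subset_topspace[OF that] by blast
  then show ?thesis
    by (auto simp: CC_diamond_def CC_box_def)
qed

text \<open>The complement of a box is the diamond of the complement, which is again
  subbasic.\<close>

lemma clopenin_CC_box: "clopenin X V \<Longrightarrow> clopenin (CC_topology X r) (CC_box X r V)"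
proof -
  assume V: "clopenin X V"
  have "CC X r - CC_box X r V = CC_diamond X r (topspace X - V)"
    unfolding CC_box_eq by (auto simp: CC_diamond_def)
  then have "openin (CC_topology X r) (CC X r - CC_box X r V)"
    using V by (simp add: openin_CC_diamond clopenin_Diff clopenin_topspace)
  moreover have "CC_box X r V \<subseteq> CC X r"
    by (auto simp: CC_box_def)
  ultimately show ?thesis
    using V by (simp add: clopenin_def[of "CC_topology X r"] openin_CC_box closedin_def topspace_CC_topology)
qed

lemma clopenin_CC_diamond: "clopenin X V \<Longrightarrow> clopenin (CC_topology X r) (CC_diamond X r V)"
  using clopenin_Diff[OF clopenin_topspace[of "CC_topology X r"] clopenin_CC_box[of X "topspace X - V" r]]
  by (simp add: CC_diamond_eq topspace_CC_topology clopenin_Diff clopenin_topspace)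

text \<open>Boxes merge under intersection, so a single \<open>V\<close> suffices; diamonds do not,
  which leaves a finite family \<open>\<W>\<close>.\<close>

lemma CC_topology_base:
  assumes "openin (CC_topology X r) S" "C \<in> S"
  obtains V \<W> where "clopenin X V" "finite \<W>" "\<And>W. W \<in> \<W> \<Longrightarrow> clopenin X W"
    "C \<in> CC_box X r V \<inter> (\<Inter>W\<in>\<W>. CC_diamond X r W)"
    "CC_box X r V \<inter> (\<Inter>W\<in>\<W>. CC_diamond X r W) \<subseteq> S"
proof -
  have "generate_topology_on ({CC_box X r V |V. clopenin X V} \<union> {CC_diamond X r V |V. clopenin X V}) S"
    using assms(1) by (simp add: CC_topology_def openin_topology_generated_by_iff)
  then have "\<exists>V \<W>. clopenin X V \<and> finite \<W> \<and> (\<forall>W\<in>\<W>. clopenin X W) \<and>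
      C \<in> CC_box X r V \<inter> (\<Inter>W\<in>\<W>. CC_diamond X r W) \<and>
      CC_box X r V \<inter> (\<Inter>W\<in>\<W>. CC_diamond X r W) \<subseteq> S"
    using assms(2)
  proof (induction S)
    case Empty
    then show ?case by simp
  next
    case (Int a b)
    obtain V \<W> where
      "clopenin X V" "finite \<W>" "\<forall>W\<in>\<W>. clopenin X W"
      "C \<in> CC_box X r V \<inter> (\<Inter>W\<in>\<W>. CC_diamond X r W)"
      "CC_box X r V \<inter> (\<Inter>W\<in>\<W>. CC_diamond X r W) \<subseteq> a"
      using Int.IH(1) Int.prems by (auto 0 0 simp del: INT_iff)
    moreover obtain V' \<W>' where "clopenin X V'" "finite \<W>'" "\<forall>W\<in>\<W>'. clopenin X W"
      "C \<in> CC_box X r V' \<inter> (\<Inter>W\<in>\<W>'. CC_diamond X r W)"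
      "CC_box X r V' \<inter> (\<Inter>W\<in>\<W>'. CC_diamond X r W) \<subseteq> b"
      using Int.IH(2) Int.prems by (auto 0 0 simp del: INT_iff)
    moreover have "CC_box X r (V \<inter> V') = CC_box X r V \<inter> CC_box X r V'"
      by (auto simp: CC_box_def)
    ultimately show ?case
      by (intro exI[of _ "V \<inter> V'"] exI[of _ "\<W> \<union> \<W>'"]) (auto simp: clopenin_Int)
  next
    case (UN K)
    then obtain k where "k \<in> K" "C \<in> k"
      by blast
    with UN.IH[OF this] obtain V \<W> where base:
      "clopenin X V" "finite \<W>" "\<forall>W\<in>\<W>. clopenin X W"
      "C \<in> CC_box X r V \<inter> (\<Inter>W\<in>\<W>. CC_diamond X r W)"
      "CC_box X r V \<inter> (\<Inter>W\<in>\<W>. CC_diamond X r W) \<subseteq> k"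
      by (auto 0 0 simp del: INT_iff)
    show ?case
      by (rule exI[of _ V], rule exI[of _ \<W>])
        (intro conjI base(1-4) order_trans[OF base(5) Union_upper[OF \<open>k \<in> K\<close>]])
  next
    case (Basis s)
    then consider V where "s = CC_box X r V" "clopenin X V" | V where "s = CC_diamond X r V" "clopenin X V"
      by blast
    then show ?case
    proof cases
      case 1
      then show ?thesis
        using Basis by (intro exI[of _ V] exI[of _ "{}"]) auto
    next
      case 2
      \<comment> \<open>A lone diamond is paired with the box of the whole space, which imposes no
        condition.\<close>
      then have "C \<in> CC_box X r (topspace X)"
        using Basis CC_subset_topspace[of C X r] by (auto simp: CC_box_def CC_diamond_def)
      with 2 show ?thesis
        using Basis by (intro exI[of _ "topspace X"] exI[of _ "{V}"]) (auto simp: clopenin_topspace)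
    qed
  qed
  then show ?thesis
    using that by metis
qed

section \<open>Compactness of the space of closed chains\<close>

text \<open>\<open>Alexander_subbase\<close> speaks of the topology on the left,
  \<open>CC_topology\<close> is defined by the one on the right.\<close>

lemma topology_generated_by_eq_subbase:
  "topology (arbitrary union_of (finite intersection_of (\<lambda>x. x \<in> \<B>) relative_to \<Union>\<B>)) =
    topology_generated_by \<B>"
  (is "?T = _")
proof -
  have "openin ?T S" if "openin (topology_generated_by \<B>) S" for S
    using openin_topology_generated_by[OF that]
  proof induction
    case (Basis s)
    then have "(finite intersection_of (\<lambda>x. x \<in> \<B>) relative_to \<Union>\<B>) (\<Union>\<B> \<inter> s)"
      by (intro relative_to_inc finite_intersection_of_inc)
    moreover have "\<Union>\<B> \<inter> s = s"
      using Basis by blast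
    ultimately show ?case
      by (simp add: openin_subbase arbitrary_union_of_inc)
  qed auto
  moreover have "openin (topology_generated_by \<B>) S" if "openin ?T S" for S
  proof (rule minimal_topology_subbase[OF _ _ that])
    show "openin (topology_generated_by \<B>) (\<Union>\<B>)"
      by (rule openin_topspace[of "topology_generated_by \<B>", unfolded topology_generated_by_topspace])
  qed (rule topology_generated_by_Basis)
  ultimately show ?thesis
    by (auto simp: topology_eq)
qed

text \<open>Every set is a chain for the order \<open>UNIV\<close>, so \<open>CC X UNIV\<close> consists of all nonempty closed
  sets and \<open>CC_topology X UNIV\<close> is the full Vietoris space.\<close>

lemma compact_space_CC_topology_UNIV:
  assumes "compact_space X"
  shows "compact_space (CC_topology X UNIV)"
proof (rule Alexander_subbase)
  let ?box = "CC_box X UNIV" and ?dia = "CC_diamond X UNIV"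
  let ?\<B> = "{?box V |V. clopenin X V} \<union> {?dia V |V. clopenin X V}"
  show "topology (arbitrary union_of (finite intersection_of (\<lambda>x. x \<in> ?\<B>) relative_to \<Union>?\<B>)) =
      CC_topology X UNIV"
    unfolding topology_generated_by_eq_subbase CC_topology_def ..
  fix \<C>
  assume \<C>: "\<C> \<subseteq> ?\<B>" "\<Union>\<C> = topspace (CC_topology X UNIV)"
  \<comment> \<open>\<open>C\<close> consists of the points missed by all \<open>W\<close> whose
    diamond is in the cover. If \<open>C\<close> is nonempty, it is a point of the Vietoris space
    lying in none of these diamonds, so the cover must catch it by a box \<open>V\<close>. If it is
    empty, \<open>V = {}\<close> has an empty box.\<close>
  define \<D> where "\<D> = {W. clopenin X W \<and> ?dia W \<in> \<C>}"
  define C where "C = topspace X - \<Union>\<D>"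
  have "openin X (\<Union>\<D>)"
    by (auto simp: \<D>_def clopenin_def)
  then have C: "closedin X C"
    by (simp add: C_def closedin_diff)
  have "\<exists>V \<F>. clopenin X V \<and> C \<subseteq> V \<and> finite \<F> \<and> \<F> \<subseteq> \<C> \<and> ?box V \<subseteq> \<Union>\<F>"
  proof (cases "C = {}")
    case True
    moreover have "?box {} = {}"
      by (auto simp: CC_box_def CC_def)
    ultimately show ?thesis
      by (intro exI[of _ "{}"]) (auto simp: clopenin_empty)
  next
    case False
    then have "C \<in> CC X UNIV"
      using C by (auto simp: CC_def Chains_def)
    then obtain S where S: "S \<in> \<C>" "C \<in> S"
      using \<C>(2) by (auto simp: topspace_CC_topology)
    have "S \<noteq> ?dia W" if "clopenin X W" for W
      using S that by (auto simp: \<D>_def C_def CC_diamond_def)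
    then obtain V where "clopenin X V" "S = ?box V"
      using S(1) \<C>(1) by blast
    then show ?thesis
      using S by (intro exI[of _ V] exI[of _ "{S}"]) (auto simp: CC_box_def)
  qed
  then obtain V \<F> where V: "clopenin X V" "C \<subseteq> V" "finite \<F>" "\<F> \<subseteq> \<C>" "?box V \<subseteq> \<Union>\<F>"
    by blast
  \<comment> \<open>The sets in the box of \<open>V\<close> are dealt with. Any other closed set
    meets the complement of \<open>V\<close>, which is compact and covered by \<open>\<D>\<close>,
    so finitely many diamonds catch all of these.\<close>
  have "compactin X (topspace X - V)"
    using clopenin_Diff[OF clopenin_topspace V(1)] closedin_compact_space[OF assms]
    by (simp add: clopenin_def)
  moreover have "\<forall>W\<in>\<D>. openin X W" "topspace X - V \<subseteq> \<Union>\<D>"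
    using V(2) by (auto simp: \<D>_def C_def clopenin_def)
  ultimately obtain \<G> where \<G>: "finite \<G>" "\<G> \<subseteq> \<D>" "topspace X - V \<subseteq> \<Union>\<G>"
    using compactinD by meson
  have sub: "\<F> \<union> ?dia ` \<G> \<subseteq> \<C>"
    using V(4) \<G>(2) by (auto simp: \<D>_def)
  have "D \<in> \<Union>(\<F> \<union> ?dia ` \<G>)" if D: "D \<in> CC X UNIV" for D
  proof (cases "D \<subseteq> V")
    case True
    then show ?thesis
      using D V(5) by (auto simp: CC_box_def)
  next
    case False
    then obtain x W where "x \<in> D" "x \<in> W" "W \<in> \<G>"
      using \<G>(3) CC_subset_topspace[OF D] by blast
    then show ?thesis
      using D by (auto simp: CC_diamond_def)
  qed
  then have "\<Union>(\<F> \<union> ?dia ` \<G>) = topspace (CC_topology X UNIV)"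
    using Union_mono[OF sub] \<C>(2) by (intro subset_antisym) (simp_all add: topspace_CC_topology subsetI)
  then show "\<exists>\<C>'. finite \<C>' \<and> \<C>' \<subseteq> \<C> \<and> \<Union>\<C>' = topspace (CC_topology X UNIV)"
    using sub V(3) \<G>(1) by (intro exI[of _ "\<F> \<union> ?dia ` \<G>"]) auto
qed

lemma CC_subset_CC_UNIV: "CC X r \<subseteq> CC X UNIV"
  by (auto simp: CC_def Chains_def)

lemma closedin_CC:
  assumes "priestley_space X r"
  shows "closedin (CC_topology X UNIV) (CC X r)"
proof -
  have "\<exists>T. openin (CC_topology X UNIV) T \<and> C \<in> T \<and> T \<subseteq> CC X UNIV - CC X r"
    if C: "C \<in> CC X UNIV - CC X r" for C
  proof -
    have "C \<notin> Chains r" "C \<subseteq> topspace X"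
      using C CC_subset_topspace[of C X UNIV] by (auto simp: CC_def)
    then obtain x y where xy: "x \<in> C" "y \<in> C" "(x, y) \<notin> r" "(y, x) \<notin> r"
        "x \<in> topspace X" "y \<in> topspace X"
      by (auto simp: Chains_def)
    obtain U V where U: "clopenin X U" "upset_of r (topspace X) U" "x \<in> U" "y \<notin> U"
      and V: "clopenin X V" "upset_of r (topspace X) V" "y \<in> V" "x \<notin> V"
      using priestley_clopen_upset[OF assms] xy by metis
    let ?T = "CC_diamond X UNIV (U - V) \<inter> CC_diamond X UNIV (V - U)"
    have "openin (CC_topology X UNIV) ?T"
      using U V by (intro openin_Int openin_CC_diamond clopenin_Diff)
    moreover have "C \<in> ?T"
      using C xy U V by (auto simp: CC_diamond_def)
    moreover have "D \<notin> CC X r" if D: "D \<in> ?T" for D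
    proof
      assume "D \<in> CC X r"
      moreover obtain u v where "u \<in> D \<inter> (U - V)" "v \<in> D \<inter> (V - U)"
        using D unfolding CC_diamond_def by blast
      ultimately have "(u, v) \<in> r \<or> (v, u) \<in> r" "u \<in> U - V" "v \<in> V - U"
          "u \<in> topspace X" "v \<in> topspace X"
        using CC_subset_topspace[of D X r] by (auto simp: CC_def Chains_def)
      \<comment> \<open>As \<open>U\<close> is an upset with \<open>u\<close> inside and
        \<open>v\<close> outside, \<open>u\<close> is not below \<open>v\<close>; \<open>V\<close>
        rules out the other direction.\<close>
      then show False
        using U(2) V(2) by (auto simp: upset_of_def)
    qed
    moreover have "?T \<subseteq> CC X UNIV"
      by (auto simp: CC_diamond_def)
    ultimately show ?thesis
      by (intro exI[of _ ?T]) blast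
  qed
  then have "openin (CC_topology X UNIV) (CC X UNIV - CC X r)"
    using openin_subopen by blast
  then show ?thesis
    by (simp add: closedin_def topspace_CC_topology CC_subset_CC_UNIV)
qed

text \<open>\<open>CC X r\<close> is compact as a closed subset of the full Vietoris space. Its
  subbasic sets are traces of the Vietoris ones, so the identity from the subspace is continuous and
  carries compactness over.\<close>

lemma compact_space_CC_topology:
  assumes "priestley_space X r"
  shows "compact_space (CC_topology X r)"
proof -
  let ?S = "subtopology (CC_topology X UNIV) (CC X r)"
  have "compact_space (CC_topology X UNIV)"
    using assms by (simp add: compact_space_CC_topology_UNIV priestley_space_def)
  then have "compactin (CC_topology X UNIV) (CC X r)"
    using closedin_CC[OF assms] closedin_compact_space by blast
  then have comp: "compactin ?S (CC X r)"
    by (simp add: compactin_subtopology)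
  have top: "topspace ?S = CC X r"
    using CC_subset_CC_UNIV by (auto simp: topspace_CC_topology)
  have "continuous_map ?S (CC_topology X r) (\<lambda>C. C)"
    unfolding CC_topology_def[of X r]
  proof (rule continuous_on_generated_topo)
    fix S
    assume "S \<in> {CC_box X r V |V. clopenin X V} \<union> {CC_diamond X r V |V. clopenin X V}"
    then obtain V where V: "clopenin X V" "S = CC_box X r V \<or> S = CC_diamond X r V"
      by blast
    moreover have "CC_box X r V = CC_box X UNIV V \<inter> CC X r"
        "CC_diamond X r V = CC_diamond X UNIV V \<inter> CC X r"
      using CC_subset_CC_UNIV[of X r] by (auto simp: CC_box_def CC_diamond_def)
    ultimately have "openin ?S S"
      using openin_CC_box[of X V UNIV] openin_CC_diamond[of X V UNIV]
      by (auto simp: openin_subtopology)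
    moreover have "(\<lambda>C. C) -` S \<inter> topspace ?S = S"
      using V top by (auto simp: CC_box_def CC_diamond_def)
    ultimately show "openin ?S ((\<lambda>C. C) -` S \<inter> topspace ?S)"
      by simp
  next
    show "(\<lambda>C. C) ` topspace ?S \<subseteq>
        \<Union>({CC_box X r V |V. clopenin X V} \<union> {CC_diamond X r V |V. clopenin X V})"
      unfolding top
      using topspace_CC_topology[of X r] unfolding CC_topology_def topology_generated_by_topspace
      by simp
  qed
  from image_compactin[OF comp this] show ?thesis
    by (simp add: compact_space_def topspace_CC_topology)
qed

section \<open>Order and Priestley separation for closed chains\<close>

lemma partial_order_CC_order: "partial_order_on (CC X r) (CC_order X r)"
proof -
  have "refl_on (CC X r) (CC_order X r)"
    by (auto simp: refl_on_def CC_order_def upset_of_def)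
  moreover have "trans (CC_order X r)"
    unfolding trans_def CC_order_def upset_of_def by blast
  moreover have "antisym (CC_order X r)"
    unfolding antisym_def CC_order_def by blast
  ultimately show ?thesis
    by (auto simp: partial_order_on_def preorder_on_def CC_order_def)
qed

lemma upset_CC_box: "upset_of (CC_order X r) (CC X r) (CC_box X r V)"
  by (auto simp: upset_of_def CC_order_def CC_box_def)

text \<open>Suppose \<open>D\<close> is an upset of the chain \<open>C\<close> and has a point
  \<open>a\<close> outside \<open>U\<close>. Then \<open>C\<close> meets \<open>U \<inter> V\<close>
  in some \<open>b\<close>, which is comparable with \<open>a\<close>. Since
  \<open>b \<le> a\<close> would put \<open>a\<close> into \<open>U\<close>, it follows that
  \<open>a \<le> b\<close>, so \<open>b\<close> lies in \<open>D\<close>.\<close>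

lemma upset_CC_box_Un_diamond:
  assumes "upset_of r (topspace X) U"
  shows "upset_of (CC_order X r) (CC X r) (CC_box X r U \<union> CC_diamond X r (U \<inter> V))"
proof -
  have "D \<in> CC_box X r U \<union> CC_diamond X r (U \<inter> V)"
    if C: "C \<in> CC_box X r U \<union> CC_diamond X r (U \<inter> V)" and D: "(C, D) \<in> CC_order X r" for C D
  proof (cases "D \<subseteq> U")
    case True
    then show ?thesis
      using D by (auto simp: CC_order_def CC_box_def)
  next
    case False
    then obtain a where a: "a \<in> D" "a \<notin> U"
      by blast
    then have "a \<in> C"
      using D by (auto simp: CC_order_def)
    then obtain b where b: "b \<in> C" "b \<in> U" "b \<in> V"
      using C a by (auto simp: CC_box_def CC_diamond_def)
    have "C \<in> CC X r"
      using D by (simp add: CC_order_def)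
    then have "(a, b) \<in> r \<or> (b, a) \<in> r" "a \<in> topspace X"
      using \<open>a \<in> C\<close> b CC_subset_topspace[of C X r] by (auto simp: CC_def Chains_def)
    then have "(a, b) \<in> r"
      using assms a b by (auto simp: upset_of_def)
    then have "b \<in> D"
      using D a b by (auto simp: CC_order_def upset_of_def)
    then show ?thesis
      using D b by (auto simp: CC_diamond_def CC_order_def)
  qed
  then show ?thesis
    by (auto simp: upset_of_def CC_box_def CC_diamond_def)
qed

text \<open>The relation can fail in two ways. If \<open>D\<close> has a point outside
  \<open>C\<close>, a box around \<open>C\<close> excludes \<open>D\<close>. If \<open>D\<close> is
  contained in \<open>C\<close> but is not an upset of it, a box is joined with a diamond.\<close>

lemma CC_order_separation:
  assumes "priestley_space X r"
    and C: "C \<in> CC X r" and D: "D \<in> CC X r" and CD: "(C, D) \<notin> CC_order X r"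
  shows "\<exists>\<U>. clopenin (CC_topology X r) \<U> \<and> upset_of (CC_order X r) (CC X r) \<U> \<and> C \<in> \<U> \<and> D \<notin> \<U>"
proof -
  note comp = priestley_compact[OF assms(1)]
  have cC: "compactin X C" and cD: "compactin X D"
    using C D comp by (auto simp: CC_def closedin_compact_space)
  note top = CC_subset_topspace[OF C] CC_subset_topspace[OF D]
  show ?thesis
  proof (cases "D \<subseteq> C")
    case False
    then obtain x where x: "x \<in> D" "x \<notin> C"
      by blast
    then have "compactin X {x}" "C \<inter> {x} = {}"
      using top by auto
    then obtain V where "clopenin X V" "C \<subseteq> V" "V \<inter> {x} = {}"
      using priestley_separate_clopen[OF assms(1) cC] by metis
    then show ?thesis
      using x C by (intro exI[of _ "CC_box X r V"])
        (auto simp: clopenin_CC_box upset_CC_box, auto simp: CC_box_def)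
  next
    case True
    then obtain x y where xy: "x \<in> D" "y \<in> C" "(x, y) \<in> r" "y \<notin> D"
      using C D CD by (auto simp: CC_order_def upset_of_def)
    then have xy_top: "x \<in> topspace X" "y \<in> topspace X"
      using top by auto
    have "(y, x) \<notin> r"
      using xy partial_order_onD(3)[OF priestley_order[OF assms(1)]] by (auto dest: antisymD)
    then obtain U where U: "clopenin X U" "upset_of r (topspace X) U" "y \<in> U" "x \<notin> U"
      using priestley_clopen_upset[OF assms(1) xy_top(2,1)] by metis
    have "compactin X {y}" "{y} \<inter> D = {}"
      using xy xy_top by auto
    then obtain V where V: "clopenin X V" "{y} \<subseteq> V" "V \<inter> D = {}"
      using priestley_separate_clopen[OF assms(1) _ cD] by metis
    \<comment> \<open>The point \<open>y\<close> puts \<open>C\<close> into the diamond.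
      \<open>D\<close> is outside the box because of \<open>x\<close>, and outside the diamond
      because it misses \<open>V\<close>.\<close>
    let ?\<U> = "CC_box X r U \<union> CC_diamond X r (U \<inter> V)"
    have "clopenin (CC_topology X r) ?\<U>"
      using U V by (intro clopenin_Un clopenin_CC_box clopenin_CC_diamond clopenin_Int)
    moreover have "C \<in> ?\<U>" "D \<notin> ?\<U>"
      using C xy U V by (auto simp: CC_box_def CC_diamond_def)
    ultimately show ?thesis
      using upset_CC_box_Un_diamond[OF U(2)] by blast
  qed
qed

lemma priestley_space_CC:
  assumes "priestley_space X r"
  shows "priestley_space (CC_topology X r) (CC_order X r)"
  using compact_space_CC_topology[OF assms] partial_order_CC_order CC_order_separation[OF assms]
  by (simp add: priestley_space_def topspace_CC_topology)

section \<open>Downsets of open sets and the root system property\<close>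

text \<open>Supplies the elements above \<open>C\<close> that witness membership in a
  downset.\<close>

lemma CC_order_Int_upset:
  assumes "C \<in> CC X r" "clopenin X U" "upset_of r (topspace X) U" "C \<inter> U \<noteq> {}"
  shows "(C, C \<inter> U) \<in> CC_order X r"
proof -
  have "closedin X (C \<inter> U)"
    using assms(1,2) by (simp add: CC_def clopenin_def closedin_Int)
  then have "C \<inter> U \<in> CC X r"
    using assms(1,4) by (simp add: CC_def Chains_def)
  moreover have "upset_of r C (C \<inter> U)"
    using assms(3) CC_subset_topspace[OF assms(1)] by (auto simp: upset_of_def)
  ultimately show ?thesis
    using assms(1) by (simp add: CC_order_def)
qed

lemma openin_CC_downclosure:
  assumes "priestley_space X r" and "openin (CC_topology X r) S"
  shows "openin (CC_topology X r) (downclosure (CC_order X r) S)"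
proof (subst openin_subopen, intro ballI)
  fix C
  assume "C \<in> downclosure (CC_order X r) S"
  then obtain D where CD: "(C, D) \<in> CC_order X r" and "D \<in> S"
    by (auto simp: downclosure_def)
  then obtain V \<W> where V: "clopenin X V" and \<W>: "finite \<W>" "\<And>W. W \<in> \<W> \<Longrightarrow> clopenin X W"
    and D: "D \<in> CC_box X r V \<inter> (\<Inter>W\<in>\<W>. CC_diamond X r W)"
    and S: "CC_box X r V \<inter> (\<Inter>W\<in>\<W>. CC_diamond X r W) \<subseteq> S"
    using CC_topology_base[OF assms(2)] by metis
  have C: "C \<in> CC X r" and DX: "D \<in> CC X r" and sub: "D \<subseteq> C" and up: "upset_of r C D"
    using CD by (auto simp: CC_order_def)
  have "closedin X D" "closedin X (C - V)"
    using C DX V by (auto simp: CC_def clopenin_def)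
  then have "compactin X D" "compactin X (C - V)"
    using closedin_compact_space[OF priestley_compact[OF assms(1)]] by auto
  \<comment> \<open>A point of \<open>C\<close> above a point of the upset \<open>D\<close> lies in
    \<open>D\<close>, hence in \<open>V\<close>.\<close>
  moreover have "\<And>a b. a \<in> D \<Longrightarrow> b \<in> C - V \<Longrightarrow> (a, b) \<notin> r"
    using D up by (auto simp: CC_box_def upset_of_def)
  ultimately obtain U where U: "clopenin X U" "upset_of r (topspace X) U" "D \<subseteq> U" "U \<inter> (C - V) = {}"
    using priestley_separate_upset[OF assms(1)] by metis
  \<comment> \<open>The neighbourhood \<open>?N\<close> is chosen so that
    \<open>E \<inter> U\<close> lies in the basic set around \<open>D\<close> for each
    \<open>E\<close> in it: the box of \<open>?V\<close> gives
    \<open>E \<inter> U \<subseteq> V\<close>, the diamond of \<open>U\<close> makes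
    \<open>E \<inter> U\<close> nonempty even if \<open>\<W>\<close> is empty, and the diamonds of
    \<open>U \<inter> W\<close> make it meet each \<open>W\<close>.\<close>
  let ?V = "topspace X - (U - V)"
  let ?N = "(CC_box X r ?V \<inter> CC_diamond X r U) \<inter> (\<Inter>W\<in>(\<inter>) U ` \<W>. CC_diamond X r W)"
  have "openin (CC_topology X r) (CC_box X r ?V \<inter> CC_diamond X r U)"
    using U V by (intro openin_Int openin_CC_box openin_CC_diamond clopenin_Diff clopenin_topspace)
  then have "openin (CC_topology X r) ?N"
    using \<W> U(1) by (intro openin_Int_Inter) (auto intro!: openin_CC_diamond clopenin_Int)
  moreover have "C \<in> ?N"
  proof -
    have "C \<in> CC_box X r ?V"
      using C U(4) CC_subset_topspace[OF C] by (auto simp: CC_box_def)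
    moreover have "C \<in> CC_diamond X r U"
      using C DX U(3) sub by (auto simp: CC_def CC_diamond_def)
    moreover have "C \<in> CC_diamond X r (U \<inter> W)" if "W \<in> \<W>" for W
    proof -
      have "D \<inter> W \<noteq> {}"
        using D that by (simp add: CC_diamond_def)
      then show ?thesis
        using C U(3) sub by (auto simp: CC_diamond_def)
    qed
    ultimately show ?thesis
      by blast
  qed
  moreover have "?N \<subseteq> downclosure (CC_order X r) S"
  proof
    fix E
    assume E: "E \<in> ?N"
    then have EU: "(E, E \<inter> U) \<in> CC_order X r"
      using CC_order_Int_upset[OF _ U(1,2)] by (auto simp: CC_diamond_def)
    then have "E \<inter> U \<in> CC X r"
      by (simp add: CC_order_def)
    then have "E \<inter> U \<in> CC_box X r V \<inter> (\<Inter>W\<in>\<W>. CC_diamond X r W)"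
      using E by (auto simp: CC_box_def CC_diamond_def Int_assoc)
    then show "E \<in> downclosure (CC_order X r) S"
      using EU S by (auto simp: downclosure_def)
  qed
  ultimately show "\<exists>T. openin (CC_topology X r) T \<and> C \<in> T \<and> T \<subseteq> downclosure (CC_order X r) S"
    by blast
qed

text \<open>Two upsets of a chain \<open>C\<close> are nested, and the smaller one, being an upset
  of \<open>C\<close>, is also an upset of the larger.\<close>

lemma CC_order_upclosure_chain: "upclosure (CC_order X r) {C} \<in> Chains (CC_order X r)"
proof -
  have "(D, E) \<in> CC_order X r \<or> (E, D) \<in> CC_order X r"
    if D: "(C, D) \<in> CC_order X r" and E: "(C, E) \<in> CC_order X r" for D E
  proof -
    have "C \<in> Chains r"
      using D by (simp add: CC_order_def CC_def)
    then have "D \<subseteq> E \<or> E \<subseteq> D"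
      using D E unfolding CC_order_def upset_of_def Chains_def by blast
    then show ?thesis
      using D E unfolding CC_order_def upset_of_def by blast
  qed
  then show ?thesis
    by (auto simp: Chains_def upclosure_def)
qed

theorem theorem3p12:
  fixes X :: "'a topology" and r :: "'a rel"
  assumes "priestley_space X r"
  shows "esakia_root_system (CC_topology X r) (CC_order X r)"
  unfolding esakia_root_system_def esakia_space_def clopenin_def
  \<comment> \<open>The downset of a clopen set is open by \<open>openin_CC_downclosure\<close>, and
    closed by the general Priestley fact applied to the space of closed chains itself.\<close>
  using priestley_space_CC[OF assms] openin_CC_downclosure[OF assms]
    priestley_closedin_downclosure[OF priestley_space_CC[OF assms]]
  by (simp add: CC_order_upclosure_chain)

end
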